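(* Let $k$ and $n$ be integers with $\frac{3k}{2}\leq n\leq 3k$. Let $\mathcal F$ be a $k$-uniform family of subsets of $[n]=\{1,\ldots,n\}$ (i.e. $|F|=k$ for every $F\in\mathcal F$) which contains no sunflower with $3$ petals. Then $$|\mathcal F|\leq 3\binom{n}{n/3}.$$
   Context: A family $\{F_1,\ldots,F_t\}$ of $t$ distinct subsets of $[n]$ is a sunflower with $t$ petals if $F_i\cap F_j=\bigcap_{s=1}^t F_s$ for all $1\leq i< j\leq t$. A family contains no sunflower with $3$ petals if no three distinct members of it form a sunflower with $3$ petals. *)

theory Defs
  imports Main
begin

text \<open>
  Since \<open>S\<close> is a set of sets, its members are automatically distinct. The conjunct
  \<open>finite S\<close> only matters for \<open>t = 0\<close>, because infinite sets have cardinality \<open>0\<close>.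
\<close>

definition sunflower :: "nat \<Rightarrow> 'a set set \<Rightarrow> bool" where
  "sunflower t S \<longleftrightarrow>
     finite S \<and> card S = t \<and> (\<forall>A\<in>S. \<forall>B\<in>S. A \<noteq> B \<longrightarrow> A \<inter> B = \<Inter>S)"

definition sunflower_free :: "nat \<Rightarrow> 'a set set \<Rightarrow> bool" where
  "sunflower_free t \<F> \<longleftrightarrow> \<not> (\<exists>S\<subseteq>\<F>. sunflower t S)"

definition uniform_family :: "nat \<Rightarrow> 'a set set \<Rightarrow> bool" where
  "uniform_family k \<F> \<longleftrightarrow> (\<forall>F\<in>\<F>. card F = k)"

end

theory Submission
  imports Defs Complex_Main "HOL-Library.FuncSet"
begin

text \<open>
  This is the slice rank method. Over the reals put
  \<open>T(A, B, C) = (\<Prod>i. 2 - [i \<in> A] - [i \<in> B] - [i \<in> C])\<close>, which vanishes iff some point lies in exactly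
  two of the three sets. On a uniform 3-sunflower-free family \<open>T\<close> is a diagonal tensor with nonzero
  diagonal, so its slice rank is at least the size of the family. Conversely, in every monomial
  of \<open>T\<close> one of the three groups of variables has degree at most \<open>d = \<lfloor>n/3\<rfloor>\<close>, and on \<open>k\<close>-sets with
  \<open>k \<ge> d\<close> each squarefree monomial of degree at most \<open>d\<close> is a combination of those of degree
  exactly \<open>d\<close>. Hence the slice rank is at most \<open>3 * (n choose d)\<close>.
\<close>

section \<open>Linear algebra: slice rank of diagonal tensors\<close>

text \<open>Gaussian elimination by induction on the equations: \<open>f i y\<close> is the
  coefficient of the unknown \<open>y\<close> in equation \<open>i\<close>. Each new equation that
  is not identically zero on \<open>Y\<close> costs one pivot unknown.\<close>

lemma homogeneous_system_nontrivial_solution: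
  fixes f :: "'i \<Rightarrow> 'a \<Rightarrow> 'b::field"
  assumes "finite I" "finite Y" "card I < card Y"
  shows "\<exists>g. (\<exists>y\<in>Y. g y \<noteq> 0) \<and> (\<forall>i\<in>I. (\<Sum>y\<in>Y. g y * f i y) = 0)"
  using assms
proof (induction I arbitrary: Y f rule: finite_induct)
  case empty
  then have "Y \<noteq> {}" by auto
  then show ?case by (intro exI[of _ "\<lambda>_. 1"]) auto
next
  case (insert i I)
  show ?case
  proof (cases "\<forall>y\<in>Y. f i y = 0")
    case True
    have "card I < card Y" using insert by simp
    with insert.IH[of Y f] insert.prems obtain g
      where "\<exists>y\<in>Y. g y \<noteq> 0" "\<forall>j\<in>I. (\<Sum>y\<in>Y. g y * f j y) = 0" by blast
    with True show ?thesis by (intro exI[of _ g]) auto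
  next
    case False
    then obtain p where p: "p \<in> Y" "f i p \<noteq> 0" by blast
    define Z where "Z = Y - {p}"
    have Z: "finite Z" "card I < card Z" using insert p by (auto simp: Z_def)
    \<comment> \<open>These are the coefficients of equation \<open>j\<close> after the unknown
      \<open>p\<close> has been eliminated by means of equation \<open>i\<close>.\<close>
    obtain g where g: "\<exists>y\<in>Z. g y \<noteq> 0"
        "\<forall>j\<in>I. (\<Sum>y\<in>Z. g y * (f j y - f i y * (f j p / f i p))) = 0"
      using insert.IH[OF Z, of "\<lambda>j y. f j y - f i y * (f j p / f i p)"] by blast
    define s where "s = (\<Sum>y\<in>Z. g y * f i y)"
    \<comment> \<open>The value at \<open>p\<close> is the one that equation \<open>i\<close>
      forces.\<close>
    define h where "h = g(p := - s / f i p)"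
    have sum_h: "(\<Sum>y\<in>Y. h y * f j y) = (\<Sum>y\<in>Z. g y * f j y) - s * f j p / f i p" for j
    proof -
      have "(\<Sum>y\<in>Y. h y * f j y) = h p * f j p + (\<Sum>y\<in>Z. h y * f j y)"
        unfolding Z_def using p insert.prems by (simp add: sum.remove)
      also have "(\<Sum>y\<in>Z. h y * f j y) = (\<Sum>y\<in>Z. g y * f j y)"
        by (intro sum.cong) (auto simp: h_def Z_def)
      finally show ?thesis by (simp add: h_def)
    qed
    have "(\<Sum>y\<in>Y. h y * f i y) = 0" using p by (simp add: sum_h flip: s_def)
    moreover have "(\<Sum>y\<in>Y. h y * f j y) = 0" if "j \<in> I" for j
    proof -
      have "0 = (\<Sum>y\<in>Z. g y * f j y - g y * f i y * (f j p / f i p))"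
        using g(2) that by (simp add: right_diff_distrib mult.assoc)
      also have "\<dots> = (\<Sum>y\<in>Z. g y * f j y) - s * (f j p / f i p)"
        unfolding s_def by (simp only: sum_subtractf sum_distrib_right)
      finally show ?thesis by (simp add: sum_h)
    qed
    moreover have "\<exists>y\<in>Y. h y \<noteq> 0" using g(1) by (auto simp: h_def Z_def)
    ultimately show ?thesis by (intro exI[of _ h]) auto
  qed
qed

text \<open>Take a solution of maximal support. If it vanished at more than \<open>card I\<close>
  points of \<open>X\<close>, a nontrivial solution living on those points could be added to it and
  would enlarge the support.\<close>

lemma orthogonal_function_large_support:
  fixes f :: "'i \<Rightarrow> 'a \<Rightarrow> 'b::field"
  assumes "finite I" "finite X"
  obtains h where "\<And>i. i \<in> I \<Longrightarrow> (\<Sum>x\<in>X. h x * f i x) = 0"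
    "card X \<le> card {x\<in>X. h x \<noteq> 0} + card I"
proof -
  define supp where "supp h = {x\<in>X. h x \<noteq> 0}" for h :: "'a \<Rightarrow> 'b"
  define Q where "Q h \<longleftrightarrow> (\<forall>i\<in>I. (\<Sum>x\<in>X. h x * f i x) = 0)" for h
  have "Q (\<lambda>_. 0)" by (simp add: Q_def)
  moreover have "\<forall>h. Q h \<longrightarrow> card (supp h) < Suc (card X)"
    using assms by (auto simp: supp_def less_Suc_eq_le intro!: card_mono)
  ultimately obtain h where h: "Q h" "\<And>g. Q g \<Longrightarrow> card (supp g) \<le> card (supp h)"
    using ex_has_greatest_nat[of Q _ "\<lambda>h. card (supp h)"] by blast
  have "card X \<le> card (supp h) + card I"
  proof (rule ccontr)
    assume "\<not> ?thesis"
    define Y where "Y = X - supp h"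
    have Y: "finite Y" "Y \<subseteq> X" "card I < card Y"
      using \<open>\<not> _\<close> assms by (auto simp: Y_def supp_def card_Diff_subset)
    obtain g where g: "\<exists>y\<in>Y. g y \<noteq> 0" "\<forall>i\<in>I. (\<Sum>y\<in>Y. g y * f i y) = 0"
      using homogeneous_system_nontrivial_solution[OF assms(1) Y(1,3)] by blast
    \<comment> \<open>This is the sum of \<open>h\<close> and the extension of \<open>g\<close> by
      zero, because \<open>h\<close> vanishes on \<open>Y\<close>.\<close>
    define e where "e x = (if x \<in> Y then g x else h x)" for x
    have "(\<Sum>x\<in>X. e x * f i x) = 0" if "i \<in> I" for i
    proof -
      have "(\<Sum>x\<in>X. e x * f i x) = (\<Sum>x\<in>X. h x * f i x + (if x \<in> Y then g x * f i x else 0))"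
        by (intro sum.cong) (auto simp: e_def Y_def supp_def)
      also have "\<dots> = (\<Sum>x\<in>X. h x * f i x) + (\<Sum>x\<in>Y. g x * f i x)"
        using assms Y by (simp add: sum.distrib sum.inter_restrict[symmetric] Int_absorb1)
      finally show ?thesis using h(1) g(2) that by (simp add: Q_def)
    qed
    then have "Q e" by (simp add: Q_def)
    moreover have "supp h \<subset> supp e"
      using g(1) Y(2) by (auto simp: supp_def e_def Y_def)
    then have "card (supp h) < card (supp e)"
      using assms by (intro psubset_card_mono) (auto simp: supp_def)
    ultimately show False using h(2) by force
  qed
  with h(1) that show thesis by (auto simp: Q_def supp_def)
qed

text \<open>If \<open>S\<close> were larger, some nonzero \<open>u\<close> would be orthogonal to
  all \<open>f a\<close> and all \<open>q b\<close>. Summing the matrix against \<open>u\<close>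
  over \<open>x\<close> kills the right-hand side, while the diagonal gives
  \<open>u y * m y\<close>. The two sums are kept apart to match the two slice directions that
  survive in the tensor case.\<close>

lemma card_le_rank_diagonal:
  fixes m :: "'a \<Rightarrow> 'b::field"
  assumes "finite I" "finite J" "finite S" and nz: "\<And>x. x \<in> S \<Longrightarrow> m x \<noteq> 0"
    and eq: "\<And>x y. x \<in> S \<Longrightarrow> y \<in> S \<Longrightarrow>
      (if x = y then m x else 0) = (\<Sum>a\<in>I. f a x * g a y) + (\<Sum>b\<in>J. p b y * q b x)"
  shows "card S \<le> card I + card J"
proof (rule ccontr)
  assume "\<not> ?thesis"
  then have "card (I <+> J) < card S" using assms by (simp add: card_Plus)
  then obtain u where u: "\<exists>x\<in>S. u x \<noteq> 0"
      "\<forall>i\<in>I <+> J. (\<Sum>x\<in>S. u x * case_sum f q i x) = 0"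
    using homogeneous_system_nontrivial_solution[of "I <+> J" S "case_sum f q"] assms(1-3)
    by (auto simp only: finite_Plus)
  have uf: "(\<Sum>x\<in>S. u x * f a x) = 0" if "a \<in> I" for a
    using u(2)[rule_format, of "Inl a"] that by auto
  have uq: "(\<Sum>x\<in>S. u x * q b x) = 0" if "b \<in> J" for b
    using u(2)[rule_format, of "Inr b"] that by auto
  have "u y * m y = 0" if y: "y \<in> S" for y
  proof -
    have "u y * m y = (\<Sum>x\<in>S. u x * (if x = y then m x else 0))"
      using assms y by (simp add: if_distrib cong: if_cong)
    also have "\<dots> = (\<Sum>x\<in>S. \<Sum>a\<in>I. u x * f a x * g a y) + (\<Sum>x\<in>S. \<Sum>b\<in>J. u x * q b x * p b y)"
      unfolding sum.distrib[symmetric] using y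
      by (intro sum.cong) (simp_all add: eq sum_distrib_left distrib_left mult_ac)
    also have "\<dots> = (\<Sum>a\<in>I. (\<Sum>x\<in>S. u x * f a x) * g a y) + (\<Sum>b\<in>J. (\<Sum>x\<in>S. u x * q b x) * p b y)"
      unfolding sum_distrib_right by (intro arg_cong2[of _ _ _ _ "(+)"] sum.swap)
    also have "\<dots> = 0" by (simp add: uf uq)
    finally show ?thesis .
  qed
  with u(1) nz show False by auto
qed

text \<open>Contract the third coordinate with a function \<open>u\<close> orthogonal to every
  \<open>h c\<close>. The third sum disappears, and a matrix with diagonal \<open>u x * m x\<close>
  remains. It is nonzero on the support of \<open>u\<close>, which misses at most
  \<open>card K\<close> points, so the matrix bound applies there.\<close>

lemma card_le_slice_rank_diagonal:
  fixes m :: "'a \<Rightarrow> 'b::field"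
  assumes "finite I" "finite J" "finite K" "finite X" and nz: "\<And>x. x \<in> X \<Longrightarrow> m x \<noteq> 0"
    and eq: "\<And>x y z. x \<in> X \<Longrightarrow> y \<in> X \<Longrightarrow> z \<in> X \<Longrightarrow>
      (if x = y \<and> y = z then m x else 0) =
        (\<Sum>a\<in>I. f a x * f' a y z) + (\<Sum>b\<in>J. g b y * g' b x z) + (\<Sum>c\<in>K. h c z * h' c x y)"
  shows "card X \<le> card I + card J + card K"
proof -
  obtain u where u: "\<And>c. c \<in> K \<Longrightarrow> (\<Sum>z\<in>X. u z * h c z) = 0"
      "card X \<le> card {x\<in>X. u x \<noteq> 0} + card K"
    using orthogonal_function_large_support[OF assms(3,4)] by blast
  have "card {x\<in>X. u x \<noteq> 0} \<le> card I + card J"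
  proof (rule card_le_rank_diagonal)
    fix x y assume "x \<in> {x\<in>X. u x \<noteq> 0}" "y \<in> {x\<in>X. u x \<noteq> 0}"
    then have xy: "x \<in> X" "y \<in> X" by auto
    have "(if x = y then u x * m x else 0) = (\<Sum>z\<in>X. if y = z then (if x = y then u z * m x else 0) else 0)"
      using xy assms(4) by simp
    also have "\<dots> = (\<Sum>z\<in>X. u z * (if x = y \<and> y = z then m x else 0))"
      by (intro sum.cong) auto
    also have "\<dots> = (\<Sum>z\<in>X. \<Sum>a\<in>I. f a x * (u z * f' a y z)) + (\<Sum>z\<in>X. \<Sum>b\<in>J. g b y * (u z * g' b x z))
        + (\<Sum>z\<in>X. \<Sum>c\<in>K. u z * h c z * h' c x y)"
      unfolding sum.distrib[symmetric] using xy
      by (intro sum.cong) (simp_all only: eq sum_distrib_left distrib_left mult_ac)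
    also have "(\<Sum>z\<in>X. \<Sum>c\<in>K. u z * h c z * h' c x y) = (\<Sum>c\<in>K. (\<Sum>z\<in>X. u z * h c z) * h' c x y)"
      unfolding sum_distrib_right by (rule sum.swap)
    also have "\<dots> = 0" by (simp add: u)
    also have "(\<Sum>z\<in>X. \<Sum>a\<in>I. f a x * (u z * f' a y z)) = (\<Sum>a\<in>I. f a x * (\<Sum>z\<in>X. u z * f' a y z))"
      unfolding sum_distrib_left by (rule sum.swap)
    also have "(\<Sum>z\<in>X. \<Sum>b\<in>J. g b y * (u z * g' b x z)) = (\<Sum>b\<in>J. g b y * (\<Sum>z\<in>X. u z * g' b x z))"
      unfolding sum_distrib_left by (rule sum.swap)
    finally show "(if x = y then u x * m x else 0) =
        (\<Sum>a\<in>I. f a x * (\<Sum>z\<in>X. u z * f' a y z)) + (\<Sum>b\<in>J. g b y * (\<Sum>z\<in>X. u z * g' b x z))"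
      by simp
  qed (use assms in auto)
  with u(2) show ?thesis by linarith
qed

section \<open>Low-degree polynomials on the sets of size \<open>k\<close>\<close>

lemma card_subsets_between:
  assumes "finite A" "E \<subseteq> A" "card E \<le> d"
  shows "card {D. E \<subseteq> D \<and> D \<subseteq> A \<and> card D = d} = (card A - card E) choose (d - card E)"
proof -
  have fE: "finite E" using assms finite_subset by blast
  have "bij_betw (\<lambda>D. D - E) {D. E \<subseteq> D \<and> D \<subseteq> A \<and> card D = d} {D. D \<subseteq> A - E \<and> card D = d - card E}"
  proof (rule bij_betwI[where g = "\<lambda>D. D \<union> E"])
    show "(\<lambda>D. D - E) \<in> {D. E \<subseteq> D \<and> D \<subseteq> A \<and> card D = d} \<rightarrow> {D. D \<subseteq> A - E \<and> card D = d - card E}"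
      using fE by (auto simp: card_Diff_subset)
    show "(\<lambda>D. D \<union> E) \<in> {D. D \<subseteq> A - E \<and> card D = d - card E} \<rightarrow> {D. E \<subseteq> D \<and> D \<subseteq> A \<and> card D = d}"
    proof
      fix D assume D: "D \<in> {D. D \<subseteq> A - E \<and> card D = d - card E}"
      then have "finite D" using assms(1) by (auto intro: finite_subset)
      with D fE assms show "D \<union> E \<in> {D. E \<subseteq> D \<and> D \<subseteq> A \<and> card D = d}"
        by (subst mem_Collect_eq, subst card_Un_disjoint) auto
    qed
  qed auto
  then have "card {D. E \<subseteq> D \<and> D \<subseteq> A \<and> card D = d} = card {D. D \<subseteq> A - E \<and> card D = d - card E}"
    by (rule bij_betw_same_card)
  also have "\<dots> = (card A - card E) choose (d - card E)"
    using assms fE by (simp add: n_subsets card_Diff_subset)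
  finally show ?thesis .
qed

text \<open>Here \<open>of_bool (D \<subseteq> A)\<close> is the squarefree monomial with support
  \<open>D\<close>, evaluated at the indicator vector of \<open>A\<close>. Double counting: if
  \<open>E \<subseteq> A\<close>, the number of \<open>d\<close>-sets between \<open>E\<close> and
  \<open>A\<close> is the binomial in the denominator, otherwise there are none. That number depends
  on \<open>A\<close> only through its size \<open>k\<close>, so the coefficients are the same for
  all \<open>A\<close>.\<close>

lemma low_degree_monomial_on_slice:
  assumes "finite N" "A \<subseteq> N" "card A = k" "card E \<le> d" "d \<le> k"
  shows "(of_bool (E \<subseteq> A) :: real) =
    (\<Sum>D | D \<subseteq> N \<and> card D = d.
      of_bool (D \<subseteq> A) * (of_bool (E \<subseteq> D) / real ((k - card E) choose (d - card E))))"
proof -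
  let ?c = "real ((k - card E) choose (d - card E))"
  have fA: "finite A" using assms finite_subset by blast
  have "(\<Sum>D | D \<subseteq> N \<and> card D = d. of_bool (D \<subseteq> A) * (of_bool (E \<subseteq> D) / ?c))
      = (\<Sum>D | D \<subseteq> N \<and> card D = d. if E \<subseteq> D \<and> D \<subseteq> A then 1 / ?c else 0)"
    by (intro sum.cong) auto
  also have "\<dots> = (\<Sum>D\<in>{D\<in>{D. D \<subseteq> N \<and> card D = d}. E \<subseteq> D \<and> D \<subseteq> A}. 1 / ?c)"
    using assms(1) by (intro sum.inter_filter[symmetric]) auto
  also have "{D\<in>{D. D \<subseteq> N \<and> card D = d}. E \<subseteq> D \<and> D \<subseteq> A} = {D. E \<subseteq> D \<and> D \<subseteq> A \<and> card D = d}"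
    using assms(2) by blast
  also have "(\<Sum>D\<in>\<dots>. 1 / ?c) = of_bool (E \<subseteq> A)"
  proof (cases "E \<subseteq> A")
    case True
    \<comment> \<open>From \<open>d \<le> k\<close>, the lower index \<open>d - card E\<close> is at
      most the upper index \<open>k - card E\<close>.\<close>
    have "?c \<noteq> 0" using assms by simp
    with True show ?thesis using card_subsets_between[OF fA True assms(4)] assms(3) by simp
  next
    case False
    then have empty: "{D. E \<subseteq> D \<and> D \<subseteq> A \<and> card D = d} = {}" by blast
    show ?thesis unfolding empty using False by simp
  qed
  finally show ?thesis by simp
qed

text \<open>Linear extension of the monomial case. In the application \<open>w\<close> carries the
  coefficient together with the monomials in the other two sets. Bounding degrees only where
  \<open>w\<close> is nonzero lets the sum run over all exponent patterns.\<close>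

lemma low_degree_polynomial_on_slice:
  fixes w :: "'p \<Rightarrow> real"
  assumes "finite N" "A \<subseteq> N" "card A = k" "d \<le> k"
    and "\<And>\<phi>. \<phi> \<in> \<Phi> \<Longrightarrow> w \<phi> \<noteq> 0 \<Longrightarrow> card (P \<phi>) \<le> d"
  shows "(\<Sum>\<phi>\<in>\<Phi>. of_bool (P \<phi> \<subseteq> A) * w \<phi>) =
    (\<Sum>D | D \<subseteq> N \<and> card D = d. of_bool (D \<subseteq> A) *
      (\<Sum>\<phi>\<in>\<Phi>. of_bool (P \<phi> \<subseteq> D) / real ((k - card (P \<phi>)) choose (d - card (P \<phi>))) * w \<phi>))"
proof -
  let ?l = "\<lambda>\<phi> D. of_bool (P \<phi> \<subseteq> D) / real ((k - card (P \<phi>)) choose (d - card (P \<phi>)))"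
  have "(\<Sum>\<phi>\<in>\<Phi>. of_bool (P \<phi> \<subseteq> A) * w \<phi>)
      = (\<Sum>\<phi>\<in>\<Phi>. \<Sum>D | D \<subseteq> N \<and> card D = d. of_bool (D \<subseteq> A) * (?l \<phi> D * w \<phi>))"
  proof (rule sum.cong)
    fix \<phi> assume "\<phi> \<in> \<Phi>"
    show "of_bool (P \<phi> \<subseteq> A) * w \<phi> = (\<Sum>D | D \<subseteq> N \<and> card D = d. of_bool (D \<subseteq> A) * (?l \<phi> D * w \<phi>))"
    proof (cases "w \<phi> = 0")
      case False
      with assms(5) \<open>\<phi> \<in> \<Phi>\<close> have "card (P \<phi>) \<le> d" by blast
      show ?thesis
        by (subst low_degree_monomial_on_slice[OF assms(1-3) \<open>card (P \<phi>) \<le> d\<close> assms(4)])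
          (simp only: sum_distrib_right mult.assoc)
    qed simp
  qed simp
  also have "\<dots> = (\<Sum>D | D \<subseteq> N \<and> card D = d. of_bool (D \<subseteq> A) * (\<Sum>\<phi>\<in>\<Phi>. ?l \<phi> D * w \<phi>))"
    by (subst sum.swap) (simp only: sum_distrib_left)
  finally show ?thesis .
qed

section \<open>The sunflower tensor and its slice decomposition\<close>

definition sunflower_tensor :: "'a set \<Rightarrow> 'a set \<Rightarrow> 'a set \<Rightarrow> 'a set \<Rightarrow> real" where
  "sunflower_tensor N A B C = (\<Prod>i\<in>N. 2 - of_bool (i \<in> A) - of_bool (i \<in> B) - of_bool (i \<in> C))"

text \<open>Multiply out the product: \<open>\<phi> i\<close> records which of the four summands is
  chosen at \<open>i\<close>, with 0 for the constant 2 and 1, 2, 3 for the negated indicators of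
  \<open>A\<close>, \<open>B\<close>, \<open>C\<close>.\<close>

lemma sunflower_tensor_expand:
  assumes "finite N"
  shows "sunflower_tensor N A B C =
    (\<Sum>\<phi>\<in>N \<rightarrow>\<^sub>E {0,1,2,3::nat}. (\<Prod>i\<in>N. if \<phi> i = 0 then 2 else -1) *
      of_bool ({i\<in>N. \<phi> i = 1} \<subseteq> A) * of_bool ({i\<in>N. \<phi> i = 2} \<subseteq> B) * of_bool ({i\<in>N. \<phi> i = 3} \<subseteq> C))"
proof -
  \<comment> \<open>Each summand is written as a product of a coefficient and three factors, one for
    each set, so that the product over \<open>N\<close> separates into the coefficient and three
    monomials.\<close>
  define t :: "'a \<Rightarrow> nat \<Rightarrow> real" where
    "t i j = (if j = 0 then 2 else -1) * (if j = 1 then of_bool (i \<in> A) else 1) *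
      (if j = 2 then of_bool (i \<in> B) else 1) * (if j = 3 then of_bool (i \<in> C) else 1)" for i j
  have monomial: "(\<Prod>i\<in>N. if \<phi> i = j then of_bool (i \<in> S) else (1::real)) = of_bool ({i\<in>N. \<phi> i = j} \<subseteq> S)"
    for \<phi> :: "'a \<Rightarrow> nat" and j S
  proof (cases "{i\<in>N. \<phi> i = j} \<subseteq> S")
    case True
    then show ?thesis by (auto intro!: prod.neutral)
  next
    case False
    then show ?thesis using assms by (auto simp: prod_zero_iff)
  qed
  have "sunflower_tensor N A B C = (\<Prod>i\<in>N. \<Sum>j\<in>{0,1,2,3}. t i j)"
    unfolding sunflower_tensor_def t_def by (intro prod.cong) auto
  also have "\<dots> = (\<Sum>\<phi>\<in>N \<rightarrow>\<^sub>E {0,1,2,3}. \<Prod>i\<in>N. t i (\<phi> i))"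
    using assms by (intro prod_sum_PiE) auto
  finally show ?thesis by (simp only: t_def prod.distrib monomial)
qed

lemma sunflower_tensor_eq_0:
  assumes "finite N" "i \<in> N"
    and "of_bool (i \<in> A) + of_bool (i \<in> B) + of_bool (i \<in> C) = (2::real)"
  shows "sunflower_tensor N A B C = 0"
  unfolding sunflower_tensor_def
  using assms by (intro prod_zero bexI[of _ i]) auto

text \<open>If no point lies in exactly two of the sets, every pairwise intersection is contained in
  the third set and so equals the triple intersection.\<close>

lemma sunflower_3I:
  assumes "A \<noteq> B" "A \<noteq> C" "B \<noteq> C"
    and "\<And>i. of_bool (i \<in> A) + of_bool (i \<in> B) + of_bool (i \<in> C) \<noteq> (2::real)"
  shows "sunflower 3 {A, B, C}"
proof -
  have "i \<in> A \<and> i \<in> B \<longrightarrow> i \<in> C" "i \<in> A \<and> i \<in> C \<longrightarrow> i \<in> B" "i \<in> B \<and> i \<in> C \<longrightarrow> i \<in> A" for i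
    using assms(4)[of i] by auto
  then have "A \<inter> B = A \<inter> B \<inter> C" "A \<inter> C = A \<inter> B \<inter> C" "B \<inter> C = A \<inter> B \<inter> C" by blast+
  then have "\<forall>S\<in>{A, B, C}. \<forall>T\<in>{A, B, C}. S \<noteq> T \<longrightarrow> S \<inter> T = A \<inter> B \<inter> C"
    by (simp add: Int_commute)
  moreover have "\<Inter>{A, B, C} = A \<inter> B \<inter> C" by auto
  ultimately show ?thesis using assms(1-3) unfolding sunflower_def by simp
qed

text \<open>Off the diagonal some point lies in exactly two of the sets. For three distinct sets
  this is sunflower-freeness. If exactly two coincide, it is uniformity: the repeated set is not
  contained in the other one.\<close>

lemma sunflower_tensor_diagonal:
  assumes "finite N" "\<F> \<subseteq> Pow N" "uniform_family k \<F>" "sunflower_free 3 \<F>"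
    and "A \<in> \<F>" "B \<in> \<F>" "C \<in> \<F>"
  shows "(if A = B \<and> B = C then sunflower_tensor N A A A else 0) = sunflower_tensor N A B C"
proof -
  have not_subset: "\<exists>i\<in>N. i \<in> S \<and> i \<notin> T" if "S \<in> \<F>" "T \<in> \<F>" "S \<noteq> T" for S T
  proof -
    have "T \<subseteq> N" using that assms(2) by blast
    then have "finite T" "card S = card T"
      using that assms(1,3) by (auto simp: uniform_family_def intro: finite_subset)
    then have "\<not> S \<subseteq> T" using that card_subset_eq by blast
    then show ?thesis using that assms(2) by blast
  qed
  show ?thesis
  proof (cases "A = B \<and> B = C")
    case False
    have "\<exists>i\<in>N. of_bool (i \<in> A) + of_bool (i \<in> B) + of_bool (i \<in> C) = (2::real)"
    proof (cases "A = B \<or> A = C \<or> B = C")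
      case True
      then consider "A = B" "A \<noteq> C" | "A = C" "A \<noteq> B" | "B = C" "B \<noteq> A" using False by blast
      then show ?thesis
      proof cases
        case 1
        with not_subset[OF assms(5,7)] show ?thesis by (auto intro: bexI)
      next
        case 2
        with not_subset[OF assms(5,6)] show ?thesis by (auto intro: bexI)
      next
        case 3
        with not_subset[OF assms(6,5)] show ?thesis by (auto intro: bexI)
      qed
    next
      case distinct: False
      have "\<not> sunflower 3 {A, B, C}"
        using assms by (auto simp: sunflower_free_def)
      then obtain i where i: "of_bool (i \<in> A) + of_bool (i \<in> B) + of_bool (i \<in> C) = (2::real)"
        using sunflower_3I[of A B C] distinct by blast
      \<comment> \<open>A point in two of the three sets lies in \<open>A\<close> or
        \<open>B\<close>, hence in \<open>N\<close>, where it contributes a zero factor.\<close>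
      then have "i \<in> A \<or> i \<in> B" by (auto simp: of_bool_def split: if_splits)
      then have "i \<in> N" using assms by blast
      with i show ?thesis by blast
    qed
    then show ?thesis using False sunflower_tensor_eq_0[OF assms(1)] by auto
  qed auto
qed

lemma sunflower_tensor_slices:
  assumes "finite N" "card N div 3 \<le> k"
  obtains f g h :: "'a set \<Rightarrow> 'a set \<Rightarrow> 'a set \<Rightarrow> real" where
    "\<And>A B C. \<lbrakk>A \<subseteq> N; card A = k; B \<subseteq> N; card B = k; C \<subseteq> N; card C = k\<rbrakk> \<Longrightarrow>
      sunflower_tensor N A B C =
        (\<Sum>D | D \<subseteq> N \<and> card D = card N div 3. of_bool (D \<subseteq> A) * f D B C) +
        (\<Sum>D | D \<subseteq> N \<and> card D = card N div 3. of_bool (D \<subseteq> B) * g D A C) +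
        (\<Sum>D | D \<subseteq> N \<and> card D = card N div 3. of_bool (D \<subseteq> C) * h D A B)"
proof -
  define d where "d = card N div 3"
  define \<Phi> where "\<Phi> = (N \<rightarrow>\<^sub>E {0,1,2,3::nat})"
  define P where "P j \<phi> = {i\<in>N. \<phi> i = j}" for j :: nat and \<phi> :: "'a \<Rightarrow> nat"
  define c :: "('a \<Rightarrow> nat) \<Rightarrow> real" where "c \<phi> = (\<Prod>i\<in>N. if \<phi> i = 0 then 2 else -1)" for \<phi>
  \<comment> \<open>Each term of the expansion is assigned to the first \<open>j\<close> whose
    support \<open>P j \<phi>\<close> has at most \<open>d\<close> points, so that no term is
    counted twice.\<close>
  define v where "v j \<phi> = (if card (P j \<phi>) \<le> d \<and> (\<forall>j'\<in>{1..<j}. \<not> card (P j' \<phi>) \<le> d) then c \<phi> else 0)"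
    for j \<phi>
  define l :: "nat \<Rightarrow> ('a \<Rightarrow> nat) \<Rightarrow> 'a set \<Rightarrow> real" where
    "l j \<phi> D = of_bool (P j \<phi> \<subseteq> D) / real ((k - card (P j \<phi>)) choose (d - card (P j \<phi>)))" for j \<phi> D
  have c_split: "c \<phi> = v 1 \<phi> + v 2 \<phi> + v 3 \<phi>" for \<phi>
  proof -
    have "card (P 1 \<phi>) + card (P 2 \<phi>) + card (P 3 \<phi>) = card (P 1 \<phi> \<union> P 2 \<phi> \<union> P 3 \<phi>)"
      using assms(1) by (subst card_Un_disjoint; (subst card_Un_disjoint)?) (auto simp: P_def)
    also have "\<dots> \<le> card N" using assms(1) by (intro card_mono) (auto simp: P_def)
    \<comment> \<open>The three supports are disjoint subsets of \<open>N\<close>, so they cannot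
      all have more than \<open>card N div 3\<close> points.\<close>
    finally have "card (P 1 \<phi>) \<le> d \<or> card (P 2 \<phi>) \<le> d \<or> card (P 3 \<phi>) \<le> d"
      unfolding d_def by linarith
    moreover have "{1..<2::nat} = {1}" "{1..<3::nat} = {1,2}" by auto
    ultimately show ?thesis by (auto simp: v_def)
  qed
  \<comment> \<open>The weight \<open>r\<close> stands for the two monomials in the other sets,
    which are constants as far as \<open>A\<close> is concerned.\<close>
  have slice: "(\<Sum>\<phi>\<in>\<Phi>. of_bool (P j \<phi> \<subseteq> A) * (v j \<phi> * r \<phi>)) =
      (\<Sum>D | D \<subseteq> N \<and> card D = d. of_bool (D \<subseteq> A) * (\<Sum>\<phi>\<in>\<Phi>. l j \<phi> D * (v j \<phi> * r \<phi>)))"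
    if "A \<subseteq> N" "card A = k" for j A and r :: "('a \<Rightarrow> nat) \<Rightarrow> real"
    unfolding l_def using that assms
    by (intro low_degree_polynomial_on_slice) (auto simp: v_def d_def split: if_splits)
  show thesis
  proof (rule that, fold d_def)
    fix A B C assume ABC: "A \<subseteq> N" "card A = k" "B \<subseteq> N" "card B = k" "C \<subseteq> N" "card C = k"
    let ?m = "\<lambda>j \<phi> S. of_bool (P j \<phi> \<subseteq> S) :: real"
    have "sunflower_tensor N A B C = (\<Sum>\<phi>\<in>\<Phi>. c \<phi> * ?m 1 \<phi> A * ?m 2 \<phi> B * ?m 3 \<phi> C)"
      unfolding sunflower_tensor_expand[OF assms(1)] \<Phi>_def c_def P_def ..
    also have "\<dots> = (\<Sum>\<phi>\<in>\<Phi>. ?m 1 \<phi> A * (v 1 \<phi> * (?m 2 \<phi> B * ?m 3 \<phi> C))) +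
        (\<Sum>\<phi>\<in>\<Phi>. ?m 2 \<phi> B * (v 2 \<phi> * (?m 1 \<phi> A * ?m 3 \<phi> C))) +
        (\<Sum>\<phi>\<in>\<Phi>. ?m 3 \<phi> C * (v 3 \<phi> * (?m 1 \<phi> A * ?m 2 \<phi> B)))"
      unfolding sum.distrib[symmetric] c_split by (intro sum.cong refl) (simp only: algebra_simps)
    finally show "sunflower_tensor N A B C =
        (\<Sum>D | D \<subseteq> N \<and> card D = d. of_bool (D \<subseteq> A) * (\<Sum>\<phi>\<in>\<Phi>. l 1 \<phi> D * (v 1 \<phi> * (?m 2 \<phi> B * ?m 3 \<phi> C)))) +
        (\<Sum>D | D \<subseteq> N \<and> card D = d. of_bool (D \<subseteq> B) * (\<Sum>\<phi>\<in>\<Phi>. l 2 \<phi> D * (v 2 \<phi> * (?m 1 \<phi> A * ?m 3 \<phi> C)))) +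
        (\<Sum>D | D \<subseteq> N \<and> card D = d. of_bool (D \<subseteq> C) * (\<Sum>\<phi>\<in>\<Phi>. l 3 \<phi> D * (v 3 \<phi> * (?m 1 \<phi> A * ?m 2 \<phi> B))))"
      using ABC by (simp only: slice)
  qed
qed

theorem theorem5:
  fixes k n :: nat and \<F> :: "nat set set"
  assumes "3 * k \<le> 2 * n" and "n \<le> 3 * k"
    and "\<F> \<subseteq> Pow {1..n}"
    and "uniform_family k \<F>"
    and "sunflower_free 3 \<F>"
  shows "card \<F> \<le> 3 * (n choose (n div 3))"
proof -
  let ?N = "{1..n}"
  let ?K = "{D. D \<subseteq> ?N \<and> card D = n div 3}"
  have card_N: "card ?N = n" by simp
  obtain f g h :: "nat set \<Rightarrow> nat set \<Rightarrow> nat set \<Rightarrow> real" where fgh: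
    "\<And>A B C. \<lbrakk>A \<subseteq> ?N; card A = k; B \<subseteq> ?N; card B = k; C \<subseteq> ?N; card C = k\<rbrakk> \<Longrightarrow>
      sunflower_tensor ?N A B C = (\<Sum>D\<in>?K. of_bool (D \<subseteq> A) * f D B C) +
        (\<Sum>D\<in>?K. of_bool (D \<subseteq> B) * g D A C) + (\<Sum>D\<in>?K. of_bool (D \<subseteq> C) * h D A B)"
    \<comment> \<open>The bound \<open>n \<le> 3 * k\<close> yields \<open>n div 3 \<le> k\<close>,
      so monomials can be raised to degree exactly \<open>n div 3\<close>.\<close>
    by (rule sunflower_tensor_slices[of ?N k, unfolded card_N]) (use assms(2) in \<open>simp, simp, blast\<close>)
  have F: "A \<subseteq> ?N" "card A = k" if "A \<in> \<F>" for A
    using assms(3,4) that by (auto simp: uniform_family_def)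
  have "card \<F> \<le> card ?K + card ?K + card ?K"
  proof (rule card_le_slice_rank_diagonal)
    show "finite \<F>" using assms(3) by (rule finite_subset) simp
    \<comment> \<open>On the diagonal every factor is 2 or -1.\<close>
    show "sunflower_tensor ?N A A A \<noteq> 0" for A
      by (auto simp: sunflower_tensor_def)
    fix A B C assume ABC: "A \<in> \<F>" "B \<in> \<F>" "C \<in> \<F>"
    show "(if A = B \<and> B = C then sunflower_tensor ?N A A A else 0) =
        (\<Sum>D\<in>?K. of_bool (D \<subseteq> A) * f D B C) +
        (\<Sum>D\<in>?K. of_bool (D \<subseteq> B) * g D A C) + (\<Sum>D\<in>?K. of_bool (D \<subseteq> C) * h D A B)"
      unfolding sunflower_tensor_diagonal[OF finite_atLeastAtMost assms(3-5) ABC]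
      using ABC F by (intro fgh) auto
  qed auto
  also have "card ?K = n choose (n div 3)" by (simp add: n_subsets)
  finally show ?thesis by simp
qed

end
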